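(* Consider the random assignment problem: minimize $\sum_{i=1}^nX_{n,(i,\pi(i))}$ over $\pi\in\operatorname{Symm}(n)$, where the cost variables $\mathbf X^n=\{X_{n,(i,j)}:1\le i,j\le n\}$ are i.i.d. with common distribution $\mathcal P$ with density $f$ supported on $[0,\infty)$, having finite mean and satisfying the rejection assumption of the context. Then this optimization problem is stable under small perturbations with perturbation blocks $\mathcal J_n=\{J_{n,(i,j)}:(i,j)\in[n]^2\}$, where $J_{n,(i,j)}=\{(i,j)\}$ for all $(i,j)\in[n]^2$.
   Context: $\operatorname{Symm}(n)$ is the group of permutations of $[n]=\{1,\dots,n\}$, with metric $d_n(\pi_1,\pi_2)=\frac1n\sum_{i=1}^n\mathbf 1(\pi_1(i)\ne\pi_2(i))$. The input index set is $I_n=[n]^2$. The minimizer is almost surely unique, denoted $\widehat\pi_n(\mathbf X^n)$. Rejection assumption: for $X\sim\mathcal P$ and $W\sim N(0,1)$ independent and any $p,s\ge0$, $\mathbb E\bigl[|W|^p\bigl(1-f(X+sW)/f(X)\bigr)_+\bigr]\le C(f,p)\,s$, with $C(f,p)$ a finite positive constant depending only on $f$ and $p$. Stability. $\mathcal J_n=\{J_{n,l}:l\in\mathcal L_n\}$ is a finite family of subsets of $I_n$ with union $I_n$; $m_n=\operatorname{card}(\mathcal L_n)$. For each $l$, $\mathbf X^{n,l}$ is an independent copy of $\mathbf X^n$ (no further assumption on the joint law over $l$), and $\mathbf X^n_l$ is $\mathbf X^n$ with the coordinates in $J_{n,l}$ replaced by those of $\mathbf X^{n,l}$. For a metric $\mathsf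 d$, $P(T,\mathsf d,\varepsilon)$ is the largest cardinality of a subset of $T$ with pairwise distances $>\varepsilon$. With $\mathcal O_{n,A}=\{\widehat\pi_n(\mathbf X^n_l):l\in A\}$, the sequence is stable under small perturbations with perturbation blocks $\mathcal J_n$ if for any $\varepsilon,\delta>0$ there is $M(\varepsilon,\delta)<\infty$ with $\limsup_{n\to\infty}\mathbb P[\min_{A\subseteq\mathcal L_n:|A|>(1-\varepsilon)m_n}P(\mathcal O_{n,A},d_n,\varepsilon)\ge M(\varepsilon,\delta)]\le\delta$. *)

theory Defs
  imports "HOL-Probability.Probability" "HOL-Combinatorics.Permutations"
begin

text \<open>
  The bound in the rejection assumption is stated with the Lebesgue integral of a nonnegative
  function, so it cannot hold because of a failure of integrability. The conventions
  \<open>a / 0 = 0\<close> and \<open>0 powr 0 = 0\<close> only matter on the null sets \<open>{f x = 0}\<close> and \<open>{w = 0}\<close>.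
\<close>

definition rejection_assumption :: "(real \<Rightarrow> real) \<Rightarrow> bool" where
  "rejection_assumption f \<longleftrightarrow>
     (\<forall>p\<ge>0. \<exists>C>0. \<forall>s\<ge>0.
        (\<integral>\<^sup>+ (x, w). ennreal (\<bar>w\<bar> powr p * max 0 (1 - f (x + s * w) / f x))
           \<partial>(density lborel (\<lambda>x. ennreal (f x)) \<Otimes>\<^sub>M density lborel (\<lambda>w. ennreal (std_normal_density w))))
        \<le> ennreal (C * s))"

text \<open>The joint law of the copy with the other copies is left unconstrained.\<close>

definition independent_copy ::
    "'w measure \<Rightarrow> 'i set \<Rightarrow> ('i \<Rightarrow> 'w \<Rightarrow> real) \<Rightarrow> ('i \<Rightarrow> 'w \<Rightarrow> real) \<Rightarrow> bool" where
  "independent_copy M I X Y \<longleftrightarrow>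
     prob_space.indep_var M
       (\<Pi>\<^sub>M e\<in>I. borel) (\<lambda>\<omega>. \<lambda>e\<in>I. X e \<omega>)
       (\<Pi>\<^sub>M e\<in>I. borel) (\<lambda>\<omega>. \<lambda>e\<in>I. Y e \<omega>) \<and>
     distr M (\<Pi>\<^sub>M e\<in>I. borel) (\<lambda>\<omega>. \<lambda>e\<in>I. Y e \<omega>) =
     distr M (\<Pi>\<^sub>M e\<in>I. borel) (\<lambda>\<omega>. \<lambda>e\<in>I. X e \<omega>)"

text \<open>Only meant for finite \<open>T\<close>.\<close>

definition packing_number :: "'s set \<Rightarrow> ('s \<Rightarrow> 's \<Rightarrow> real) \<Rightarrow> real \<Rightarrow> nat" where
  "packing_number T d \<epsilon> =
     Max {card S |S. S \<subseteq> T \<and> (\<forall>x\<in>S. \<forall>y\<in>S. x \<noteq> y \<longrightarrow> d x y > \<epsilon>)}"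

definition replace_block :: "'i set \<Rightarrow> ('i \<Rightarrow> real) \<Rightarrow> ('i \<Rightarrow> real) \<Rightarrow> 'i \<Rightarrow> real" where
  "replace_block J x y = (\<lambda>e. if e \<in> J then y e else x e)"

text \<open>
  \<open>opt n\<close> sends an input to the selected minimizer, \<open>I n\<close> is the input index set, \<open>J n l\<close> for
  \<open>l \<in> L n\<close> are the blocks, \<open>X n\<close> is the input and \<open>Y n l\<close> the independent copy of \<open>X n\<close> used
  on the block \<open>J n l\<close>. The minimum ranges over a nonempty set whenever \<open>L n\<close> is nonempty.
\<close>

definition stable_under_small_perturbations ::
    "(nat \<Rightarrow> 'w measure) \<Rightarrow> (nat \<Rightarrow> ('i \<Rightarrow> real) \<Rightarrow> 's) \<Rightarrow> (nat \<Rightarrow> 's \<Rightarrow> 's \<Rightarrow> real) \<Rightarrow>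
     (nat \<Rightarrow> 'i set) \<Rightarrow> (nat \<Rightarrow> 'l set) \<Rightarrow> (nat \<Rightarrow> 'l \<Rightarrow> 'i set) \<Rightarrow>
     (nat \<Rightarrow> 'i \<Rightarrow> 'w \<Rightarrow> real) \<Rightarrow> (nat \<Rightarrow> 'l \<Rightarrow> 'i \<Rightarrow> 'w \<Rightarrow> real) \<Rightarrow> bool" where
  "stable_under_small_perturbations M opt d I L J X Y \<longleftrightarrow>
     (\<forall>n. finite (L n) \<and> (\<Union>l\<in>L n. J n l) = I n) \<and>
     (\<forall>\<epsilon>>0. \<forall>\<delta>>0. \<exists>K::real.
        limsup (\<lambda>n. ereal (measure (M n)
          {\<omega> \<in> space (M n).
             real (Min {packing_number
                          ((\<lambda>l. opt n (replace_block (J n l) (\<lambda>e. X n e \<omega>) (\<lambda>e. Y n l e \<omega>))) ` A)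
                          (d n) \<epsilon>
                        |A. A \<subseteq> L n \<and> real (card A) > (1 - \<epsilon>) * real (card (L n))})
             \<ge> K}))
        \<le> ereal \<delta>)"

definition perm_dist :: "nat \<Rightarrow> (nat \<Rightarrow> nat) \<Rightarrow> (nat \<Rightarrow> nat) \<Rightarrow> real" where
  "perm_dist n \<pi> \<sigma> = (1 / real n) * (\<Sum>i=1..n. of_bool (\<pi> i \<noteq> \<sigma> i))"

definition assignment_index :: "nat \<Rightarrow> (nat \<times> nat) set" where
  "assignment_index n = {1..n} \<times> {1..n}"

text \<open>
  On the null event where the minimizer is not unique, \<open>arg_min\<close> picks a minimizer depending
  only on the set of all minimizers, so it is still a measurable function of the costs.
\<close>

definition optimal_assignment :: "nat \<Rightarrow> (nat \<times> nat \<Rightarrow> real) \<Rightarrow> nat \<Rightarrow> nat" where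
  "optimal_assignment n x =
     arg_min (\<lambda>\<pi>. \<Sum>i=1..n. x (i, \<pi> i)) (\<lambda>\<pi>. \<pi> permutes {1..n})"

end

theory Submission
  imports Defs
begin

text \<open>
  If resampling the single cost \<open>e\<close> changes the optimal assignment, then \<open>e\<close> is used by the optimal
  assignment before or after the change. Both events have the same probability because the
  resampled costs have the same law, and these probabilities add up to \<open>n\<close> over the \<open>n\<^sup>2\<close> edges.
  So on average at most \<open>2 n\<close> of the \<open>n\<^sup>2\<close> blocks change the optimum, and by Markov's inequality,
  with probability tending to one, all but a fraction \<open>\<epsilon>\<close> of the blocks give one and the same
  assignment.
\<close>

section \<open>Minimizers and the edges they use\<close>

definition minimizers :: "nat \<Rightarrow> (nat \<times> nat \<Rightarrow> real) \<Rightarrow> (nat \<Rightarrow> nat) set" where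
  "minimizers n x =
     {\<pi>. is_arg_min (\<lambda>\<pi>. \<Sum>i=1..n. x (i, \<pi> i)) (\<lambda>\<pi>. \<pi> permutes {1..n}) \<pi>}"

text \<open>Taking the union over all minimizers, instead of the edges of the one that
  \<open>arg_min\<close> selects, avoids any tie-breaking: membership of an edge becomes a condition
  on cost comparisons alone. Almost surely this is the edge set of the single optimal
  assignment.\<close>

definition used_edges :: "nat \<Rightarrow> (nat \<times> nat \<Rightarrow> real) \<Rightarrow> (nat \<times> nat) set" where
  "used_edges n x = (\<Union>\<pi>\<in>minimizers n x. (\<lambda>i. (i, \<pi> i)) ` {1..n})"

lemma minimizers_iff:
  "\<pi> \<in> minimizers n x \<longleftrightarrow> \<pi> permutes {1..n} \<and>
     (\<forall>\<sigma>. \<sigma> permutes {1..n} \<longrightarrow> (\<Sum>i=1..n. x (i, \<pi> i)) \<le> (\<Sum>i=1..n. x (i, \<sigma> i)))"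
  by (simp add: minimizers_def is_arg_min_linorder)

lemma finite_assignment_index [simp]: "finite (assignment_index n)"
  by (simp add: assignment_index_def)

lemma edge_in_assignment_index:
  assumes "\<pi> permutes {1..n}" "i \<in> {1..n}"
  shows "(i, \<pi> i) \<in> assignment_index n"
  using permutes_in_image[OF assms(1), of i] assms(2) by (simp add: assignment_index_def)

lemma minimizers_nonempty: "minimizers n x \<noteq> {}"
proof -
  have "finite {\<pi>. \<pi> permutes {1..n}}" by (simp add: finite_permutations)
  moreover have "{\<pi>. \<pi> permutes {1..n}} \<noteq> {}" using permutes_id by blast
  ultimately show ?thesis
    using ex_is_arg_min_if_finite[of "{\<pi>. \<pi> permutes {1..n}}" "\<lambda>\<pi>. \<Sum>i=1..n. x (i, \<pi> i)"]
    by (auto simp: minimizers_def)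
qed

lemma optimal_assignment_in_minimizers: "optimal_assignment n x \<in> minimizers n x"
  using minimizers_nonempty[of n x]
  unfolding optimal_assignment_def arg_min_def minimizers_def
  by (simp add: some_in_eq[of "{\<pi>. is_arg_min (\<lambda>\<pi>. \<Sum>i=1..n. x (i, \<pi> i)) (\<lambda>\<pi>. \<pi> permutes {1..n}) \<pi>}",
        simplified])

text \<open>Points of the product space are extensional on the index set, while inputs are total
  functions; this allows passing from one to the other.\<close>

lemma minimizers_cong:
  assumes "\<And>e. e \<in> assignment_index n \<Longrightarrow> x e = y e"
  shows "minimizers n x = minimizers n y"
proof -
  have "(\<Sum>i=1..n. x (i, \<pi> i)) = (\<Sum>i=1..n. y (i, \<pi> i))" if "\<pi> permutes {1..n}" for \<pi>
    using edge_in_assignment_index[OF that] assms by (intro sum.cong) auto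
  then show ?thesis
    unfolding set_eq_iff minimizers_iff by auto
qed

lemma minimizers_restrict: "minimizers n (\<lambda>e\<in>assignment_index n. x e) = minimizers n x"
  by (rule minimizers_cong) simp

lemma used_edges_restrict: "used_edges n (\<lambda>e\<in>assignment_index n. x e) = used_edges n x"
  by (simp add: used_edges_def minimizers_restrict)

lemma used_edges_subset: "used_edges n x \<subseteq> assignment_index n"
  using edge_in_assignment_index by (auto simp: used_edges_def minimizers_iff)

lemma optimal_assignment_edge_in_used_edges:
  "i \<in> {1..n} \<Longrightarrow> (i, optimal_assignment n x i) \<in> used_edges n x"
  unfolding used_edges_def using optimal_assignment_in_minimizers by blast

lemma card_used_edges:
  assumes "minimizers n x = {\<pi>}"
  shows "card (used_edges n x) = n"
  by (simp add: used_edges_def assms card_image inj_on_def)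

text \<open>An assignment that avoids \<open>l\<close> costs the same before and after the
  replacement. If both the old and the new optimum avoid \<open>l\<close>, the new one is therefore
  also optimal for \<open>x\<close>, and uniqueness identifies the two.\<close>

lemma optimal_assignment_replace_unused:
  assumes unique: "minimizers n x = {\<pi>}"
    and "l \<notin> used_edges n x" "l \<notin> used_edges n (replace_block {l} x y)"
  shows "optimal_assignment n (replace_block {l} x y) = optimal_assignment n x"
proof -
  define x' where "x' = replace_block {l} x y"
  define \<sigma> where "\<sigma> = optimal_assignment n x'"
  have \<pi>: "optimal_assignment n x = \<pi>"
    using optimal_assignment_in_minimizers[of n x] unique by simp
  have \<pi>_min: "\<pi> \<in> minimizers n x" using unique by simp
  have \<sigma>_min: "\<sigma> \<in> minimizers n x'"
    unfolding \<sigma>_def by (rule optimal_assignment_in_minimizers)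
  have same: "(\<Sum>i=1..n. x (i, \<tau> i)) = (\<Sum>i=1..n. x' (i, \<tau> i))"
    if "\<And>i. i \<in> {1..n} \<Longrightarrow> (i, \<tau> i) \<noteq> l" for \<tau>
    using that by (intro sum.cong) (auto simp: x'_def replace_block_def)
  have "(\<Sum>i=1..n. x (i, \<pi> i)) = (\<Sum>i=1..n. x' (i, \<pi> i))"
  proof (rule same)
    fix i assume "i \<in> {1..n}"
    from optimal_assignment_edge_in_used_edges[OF this, of x] show "(i, \<pi> i) \<noteq> l"
      using assms(2) unfolding \<pi> by blast
  qed
  moreover have "(\<Sum>i=1..n. x (i, \<sigma> i)) = (\<Sum>i=1..n. x' (i, \<sigma> i))"
  proof (rule same)
    fix i assume "i \<in> {1..n}"
    from optimal_assignment_edge_in_used_edges[OF this, of x'] show "(i, \<sigma> i) \<noteq> l"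
      using assms(3)[folded x'_def] unfolding \<sigma>_def by blast
  qed
  \<comment> \<open>The cost of \<sigma> under \<open>x\<close> equals its cost under
    \<open>x'\<close>, which is at most the cost of \<pi> under \<open>x'\<close>, which equals that
    under \<open>x\<close>.\<close>
  ultimately have "(\<Sum>i=1..n. x (i, \<sigma> i)) \<le> (\<Sum>i=1..n. x (i, \<pi> i))"
    using \<sigma>_min \<pi>_min by (simp add: minimizers_iff)
  then have "\<sigma> \<in> minimizers n x"
    using \<pi>_min \<sigma>_min by (fastforce simp: minimizers_iff)
  then show ?thesis
    using unique \<pi> by (simp add: \<sigma>_def x'_def)
qed

section \<open>Packing numbers of one-point sets\<close>

lemma packing_number_constant_image: "packing_number ((\<lambda>_. a) ` A) d \<epsilon> \<le> 1"
proof -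
  let ?\<S> = "{S. S \<subseteq> (\<lambda>_. a) ` A \<and> (\<forall>x\<in>S. \<forall>y\<in>S. x \<noteq> y \<longrightarrow> d x y > \<epsilon>)}"
  have "?\<S> \<subseteq> Pow {a}" by auto
  then have "finite ?\<S>" by (rule finite_subset) simp
  moreover have "{} \<in> ?\<S>" by simp
  moreover have "card S \<le> 1" if "S \<in> ?\<S>" for S
  proof -
    have "S \<subseteq> {a}" using that by auto
    then show ?thesis by (metis card_mono card.empty card_insert_disjoint empty_iff finite.intros One_nat_def)
  qed
  ultimately have "Max (card ` ?\<S>) \<le> 1"
    by (subst Max_le_iff) auto
  then show ?thesis
    unfolding packing_number_def by (simp add: setcompr_eq_image)
qed

text \<open>The set of all indices with value \<open>a\<close> is itself an admissible choice of
  \<open>A\<close>, and its image has at most one point.\<close>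

lemma min_packing_number_le_1:
  fixes g :: "'l \<Rightarrow> 's"
  assumes "finite L" and many: "real (card {l\<in>L. g l = a}) > c"
  shows "Min {packing_number (g ` A) d \<epsilon> |A. A \<subseteq> L \<and> real (card A) > c} \<le> 1"
proof -
  let ?A = "{l\<in>L. g l = a}"
  have "g ` ?A = (\<lambda>_. a) ` ?A" by (intro image_cong) auto
  then have le: "packing_number (g ` ?A) d \<epsilon> \<le> 1"
    using packing_number_constant_image[of a ?A d \<epsilon>] by simp
  have "{packing_number (g ` A) d \<epsilon> |A. A \<subseteq> L \<and> real (card A) > c}
      \<subseteq> (\<lambda>A. packing_number (g ` A) d \<epsilon>) ` Pow L" by auto
  then have "finite {packing_number (g ` A) d \<epsilon> |A. A \<subseteq> L \<and> real (card A) > c}"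
    by (rule finite_subset) (simp add: assms(1))
  moreover have "packing_number (g ` ?A) d \<epsilon>
      \<in> {packing_number (g ` A) d \<epsilon> |A. A \<subseteq> L \<and> real (card A) > c}"
    using many by blast
  ultimately show ?thesis using le Min_le order_trans by blast
qed

section \<open>Almost sure uniqueness of the minimizer\<close>

text \<open>Fubini in the coordinate \<open>e\<close>: with all other coordinates fixed, equality of
  the two sums forces \<open>x e\<close> to be one particular number, an event of probability zero
  because \<open>P\<close> has no atoms.\<close>

lemma AE_PiM_sum_neq:
  fixes P :: "real measure" and I J K :: "'i set"
  assumes "prob_space P" and sets_P: "sets P = sets borel" and atomless: "\<And>c. emeasure P {c} = 0"
    and I: "finite I" "J \<subseteq> I" "K \<subseteq> I" and e: "e \<in> J" "e \<notin> K"
  shows "AE x in PiM I (\<lambda>_. P). sum x J \<noteq> sum x K"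
proof -
  interpret prob_space P by fact
  interpret product_sigma_finite "\<lambda>_::'i. P" ..
  note [measurable_cong] = sets_P
  define I' where "I' = I - {e}"
  have I': "finite I'" "e \<notin> I'" "insert e I' = I" using I e by (auto simp: I'_def)
  have meas: "(\<lambda>x. sum x S) \<in> borel_measurable (PiM I (\<lambda>_. P))" if "S \<subseteq> I" for S
  proof (rule borel_measurable_sum)
    fix i assume "i \<in> S"
    then have "i \<in> I" using that by auto
    then show "(\<lambda>x. x i) \<in> borel_measurable (PiM I (\<lambda>_. P))" by measurable
  qed
  note [measurable] = meas[OF I(2)] meas[OF I(3)]
  let ?D = "{x \<in> space (PiM I (\<lambda>_. P)). sum x J = sum x K}"
  have D[measurable]: "?D \<in> sets (PiM I (\<lambda>_. P))" by measurable
  have slice: "(\<integral>\<^sup>+ y. indicator ?D (x(e := y)) \<partial>P) = 0" for x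
  proof -
    have fin: "finite J" using I finite_subset by blast
    have J: "sum (x(e := y)) J = y + sum x (J - {e})" for y
      using e fin by (subst sum.remove[of _ e]) (auto intro!: sum.cong)
    have K: "sum (x(e := y)) K = sum x K" for y
      using e by (intro sum.cong) auto
    \<comment> \<open>Solving the equation of the sums for \<open>y\<close> leaves one value. This
      is only an inequality, since \<open>?D\<close> also demands membership in the product space,
      which may fail for arbitrary \<open>x\<close>.\<close>
    have "(\<integral>\<^sup>+ y. indicator ?D (x(e := y)) \<partial>P)
        \<le> (\<integral>\<^sup>+ y. indicator {sum x K - sum x (J - {e})} y \<partial>P)"
      by (intro nn_integral_mono) (auto simp: J K indicator_def simp del: fun_upd_apply)
    also have "\<dots> = 0" using atomless by (simp add: sets_P)
    finally show ?thesis by simp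
  qed
  have "emeasure (PiM I (\<lambda>_. P)) ?D = (\<integral>\<^sup>+ x. indicator ?D x \<partial>PiM (insert e I') (\<lambda>_. P))"
    by (simp add: I')
  also have "\<dots> = 0"
    using D by (subst product_nn_integral_insert) (simp_all add: I' slice)
  finally show ?thesis
    using D by (subst AE_iff_measurable[OF D]) auto
qed

text \<open>Two distinct permutations differ at some \<open>i\<close>, so the edge
  \<open>(i, \<pi> i)\<close> lies in only one of their edge sets and their costs almost surely
  differ. There are finitely many pairs, so almost surely all costs are distinct.\<close>

lemma AE_PiM_unique_minimizer:
  fixes P :: "real measure"
  assumes P: "prob_space P" "sets P = sets borel" "\<And>c. emeasure P {c} = 0"
  shows "AE x in PiM (assignment_index n) (\<lambda>_. P). \<exists>\<pi>. minimizers n x = {\<pi>}"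
proof -
  let ?S = "{\<pi>. \<pi> permutes {1..n}}"
  have fin: "finite ?S" by (simp add: finite_permutations)
  have "AE x in PiM (assignment_index n) (\<lambda>_. P).
      \<pi> \<noteq> \<sigma> \<longrightarrow> (\<Sum>i=1..n. x (i, \<pi> i)) \<noteq> (\<Sum>i=1..n. x (i, \<sigma> i))"
    if "\<pi> \<in> ?S" "\<sigma> \<in> ?S" for \<pi> \<sigma>
  proof (cases "\<pi> = \<sigma>")
    case False
    have perm: "\<pi> permutes {1..n}" "\<sigma> permutes {1..n}" using that by auto
    obtain i where i: "\<pi> i \<noteq> \<sigma> i" using False by auto
    \<comment> \<open>Outside \<open>{1..n}\<close> both permutations are the identity and
      agree.\<close>
    then have "i \<in> {1..n}" using permutes_not_in[OF perm(1), of i] permutes_not_in[OF perm(2), of i] by fastforce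
    define E where "E \<tau> = (\<lambda>i. (i, \<tau> i)) ` {1..n}" for \<tau> :: "nat \<Rightarrow> nat"
    have sum_E: "sum x (E \<tau>) = (\<Sum>i=1..n. x (i, \<tau> i))" for x :: "nat \<times> nat \<Rightarrow> real" and \<tau>
      unfolding E_def by (subst sum.reindex) (auto simp: inj_on_def)
    have "AE x in PiM (assignment_index n) (\<lambda>_. P). sum x (E \<pi>) \<noteq> sum x (E \<sigma>)"
    proof (rule AE_PiM_sum_neq[OF P, where e = "(i, \<pi> i)"])
      show "E \<pi> \<subseteq> assignment_index n" "E \<sigma> \<subseteq> assignment_index n"
        using edge_in_assignment_index perm by (auto simp: E_def)
    qed (use i \<open>i \<in> {1..n}\<close> in \<open>auto simp: E_def\<close>)
    then show ?thesis by (simp add: sum_E)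
  qed simp
  then have "AE x in PiM (assignment_index n) (\<lambda>_. P). \<forall>\<pi>\<in>?S. \<forall>\<sigma>\<in>?S.
      \<pi> \<noteq> \<sigma> \<longrightarrow> (\<Sum>i=1..n. x (i, \<pi> i)) \<noteq> (\<Sum>i=1..n. x (i, \<sigma> i))"
    by (intro AE_finite_allI[OF fin])
  then show ?thesis
  proof (rule AE_mp, intro AE_I2 impI)
    fix x :: "nat \<times> nat \<Rightarrow> real"
    assume distinct: "\<forall>\<pi>\<in>?S. \<forall>\<sigma>\<in>?S.
      \<pi> \<noteq> \<sigma> \<longrightarrow> (\<Sum>i=1..n. x (i, \<pi> i)) \<noteq> (\<Sum>i=1..n. x (i, \<sigma> i))"
    obtain \<pi> where \<pi>: "\<pi> \<in> minimizers n x" using minimizers_nonempty by blast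
    have "minimizers n x \<subseteq> {\<pi>}"
    proof
      fix \<sigma> assume \<sigma>: "\<sigma> \<in> minimizers n x"
      have "(\<Sum>i=1..n. x (i, \<pi> i)) = (\<Sum>i=1..n. x (i, \<sigma> i))"
        using \<pi> \<sigma> by (intro order_antisym) (auto simp: minimizers_iff)
      moreover have "\<pi> \<in> ?S" "\<sigma> \<in> ?S"
        using \<pi> \<sigma> by (auto simp: minimizers_iff)
      ultimately show "\<sigma> \<in> {\<pi>}" using distinct[rule_format, of \<pi> \<sigma>] by fastforce
    qed
    then have "minimizers n x = {\<pi>}" using \<pi> by (intro equalityI) simp_all
    then show "\<exists>\<pi>. minimizers n x = {\<pi>}" by simp
  qed
qed

section \<open>Probabilities that edges are used\<close>

text \<open>The event is a finite union, over the permutations through \<open>l\<close>, of finite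
  intersections of comparisons between measurable costs.\<close>

lemma sets_used_edges:
  fixes P :: "real measure"
  assumes "sets P = sets borel"
  shows "{x \<in> space (PiM (assignment_index n) (\<lambda>_. P)). l \<in> used_edges n x}
    \<in> sets (PiM (assignment_index n) (\<lambda>_. P))"
proof -
  note [measurable_cong] = assms
  let ?Q = "PiM (assignment_index n) (\<lambda>_. P)" and ?S = "{\<pi>. \<pi> permutes {1..n}}"
  have fin: "finite ?S" by (simp add: finite_permutations)
  have cost[measurable]: "(\<lambda>x. \<Sum>i=1..n. x (i, \<pi> i)) \<in> borel_measurable ?Q" if "\<pi> \<in> ?S" for \<pi>
  proof (rule borel_measurable_sum)
    fix i assume "i \<in> {1..n}"
    then have "(i, \<pi> i) \<in> assignment_index n" using that edge_in_assignment_index by blast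
    then show "(\<lambda>x. x (i, \<pi> i)) \<in> borel_measurable ?Q" by measurable
  qed
  have "{x \<in> space ?Q. l \<in> used_edges n x} =
      (\<Union>\<pi>\<in>{\<pi>\<in>?S. l \<in> (\<lambda>i. (i, \<pi> i)) ` {1..n}}.
        {x \<in> space ?Q. \<forall>\<sigma>\<in>?S. (\<Sum>i=1..n. x (i, \<pi> i)) \<le> (\<Sum>i=1..n. x (i, \<sigma> i))})"
    by (auto simp: used_edges_def minimizers_iff)
  also have "\<dots> \<in> sets ?Q"
  proof (rule sets.finite_UN)
    fix \<pi> assume \<pi>: "\<pi> \<in> {\<pi>\<in>?S. l \<in> (\<lambda>i. (i, \<pi> i)) ` {1..n}}"
    show "{x \<in> space ?Q. \<forall>\<sigma>\<in>?S. (\<Sum>i=1..n. x (i, \<pi> i)) \<le> (\<Sum>i=1..n. x (i, \<sigma> i))} \<in> sets ?Q"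
      by (rule sets.sets_Collect_finite_All[OF _ fin])
        (use \<pi> in \<open>intro borel_measurable_le cost; auto\<close>)
  qed (use fin in simp)
  finally show ?thesis .
qed

text \<open>By linearity the sum is the expected number of used edges, and a unique minimizer uses
  exactly \<open>n\<close> of them.\<close>

lemma sum_measure_used_edges:
  fixes P :: "real measure" and n :: nat
  assumes P: "prob_space P" "sets P = sets borel" "\<And>c. emeasure P {c} = 0"
  defines "Q \<equiv> PiM (assignment_index n) (\<lambda>_. P)"
  shows "(\<Sum>l\<in>assignment_index n. measure Q {x \<in> space Q. l \<in> used_edges n x}) = real n"
proof -
  interpret Q: prob_space Q unfolding Q_def by (rule prob_space_PiM) (rule P)
  let ?U = "\<lambda>l. {x \<in> space Q. l \<in> used_edges n x}"
  have U[measurable]: "?U l \<in> sets Q" for l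
    unfolding Q_def by (rule sets_used_edges[OF P(2)])
  have "(\<Sum>l\<in>assignment_index n. measure Q (?U l)) =
      (\<Sum>l\<in>assignment_index n. \<integral>x. indicator (?U l) x \<partial>Q)"
    by (intro sum.cong) (simp_all add: Int_absorb2)
  also have "\<dots> = (\<integral>x. (\<Sum>l\<in>assignment_index n. indicator (?U l) x) \<partial>Q)"
    by (subst Bochner_Integration.integral_sum) (auto simp: Q.emeasure_eq_measure)
  also have "\<dots> = (\<integral>x. real n \<partial>Q)"
  \<comment> \<open>The identity holds only almost everywhere: with ties, \<open>used_edges\<close>
    can have more than \<open>n\<close> elements.\<close>
  proof (rule integral_cong_AE)
    have "AE x in Q. x \<in> space Q" by simp
    moreover have "AE x in Q. \<exists>\<pi>. minimizers n x = {\<pi>}"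
      unfolding Q_def by (rule AE_PiM_unique_minimizer[OF P])
    ultimately show "AE x in Q. (\<Sum>l\<in>assignment_index n. indicator (?U l) x) = real n"
    proof eventually_elim
      case (elim x)
      have "(\<Sum>l\<in>assignment_index n. indicator (?U l) x) = real (card (used_edges n x))"
        using elim used_edges_subset[of n x]
        by (simp add: indicator_def Int_absorb1 flip: sum.inter_filter)
      then show ?case using elim card_used_edges by auto
    qed
  qed simp_all
  also have "\<dots> = real n" by (simp add: Q.prob_space)
  finally show ?thesis .
qed

section \<open>The law of the costs after resampling one of them\<close>

text \<open>The new vector reads coordinate \<open>l\<close> from \<open>Y\<close> and the others
  from \<open>X\<close>. By independence of the two vectors, box probabilities factor, and boxes
  determine the product measure.\<close>

lemma (in prob_space) distr_replace_one:
  fixes X Y :: "'i \<Rightarrow> 'a \<Rightarrow> real" and P :: "real measure"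
  assumes I: "finite I" "l \<in> I" and P: "prob_space P" "sets P = sets borel"
    and law: "distr M (PiM I (\<lambda>_. borel)) (\<lambda>\<omega>. \<lambda>e\<in>I. X e \<omega>) = PiM I (\<lambda>_. P)"
    and copy: "independent_copy M I X Y"
  shows "(\<lambda>\<omega>. \<lambda>e\<in>I. replace_block {l} (\<lambda>e. X e \<omega>) (\<lambda>e. Y e \<omega>) e)
      \<in> measurable M (PiM I (\<lambda>_. borel))" (is "?R \<in> _")
    and "distr M (PiM I (\<lambda>_. borel))
        (\<lambda>\<omega>. \<lambda>e\<in>I. replace_block {l} (\<lambda>e. X e \<omega>) (\<lambda>e. Y e \<omega>) e) = PiM I (\<lambda>_. P)"
proof -
  let ?B = "PiM I (\<lambda>_. borel :: real measure)"
  let ?X = "\<lambda>\<omega>. \<lambda>e\<in>I. X e \<omega>" and ?Y = "\<lambda>\<omega>. \<lambda>e\<in>I. Y e \<omega>"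
  interpret P: prob_space P by fact
  interpret product_sigma_finite "\<lambda>_::'i. P" ..
  have ind: "indep_var ?B ?X ?B ?Y" and lawY: "distr M ?B ?Y = PiM I (\<lambda>_. P)"
    using copy law by (auto simp: independent_copy_def)
  have X_meas: "?X \<in> measurable M ?B" and Y_meas: "?Y \<in> measurable M ?B"
    using ind by (auto dest: indep_var_rv1 indep_var_rv2)
  have X_comp: "X e \<in> borel_measurable M" if "e \<in> I" for e
    using measurable_compose[OF X_meas measurable_component_singleton[OF that]] that by simp
  have Y_comp: "Y e \<in> borel_measurable M" if "e \<in> I" for e
    using measurable_compose[OF Y_meas measurable_component_singleton[OF that]] that by simp
  show R_meas: "?R \<in> measurable M ?B"
  proof (rule measurable_restrict)
    fix e assume "e \<in> I"
    then show "(\<lambda>\<omega>. replace_block {l} (\<lambda>e. X e \<omega>) (\<lambda>e. Y e \<omega>) e) \<in> borel_measurable M"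
      by (cases "e = l") (simp_all add: replace_block_def X_comp Y_comp)
  qed
  show "distr M ?B ?R = PiM I (\<lambda>_. P)"
  proof (rule PiM_eqI)
    show "sets (distr M ?B ?R) = sets (PiM I (\<lambda>_. P))"
      using P(2) by (simp cong: sets_PiM_cong)
    fix A assume "\<And>i. i \<in> I \<Longrightarrow> A i \<in> sets P"
    then have A: "A i \<in> sets borel" if "i \<in> I" for i using that P(2) by simp
    \<comment> \<open>The box splits into a condition on \<open>X\<close> away from \<open>l\<close>
      and a condition on \<open>Y\<close> at \<open>l\<close>; the free coordinates get
      \<open>UNIV\<close>, which contributes a factor 1 below.\<close>
    let ?A1 = "\<lambda>e. if e = l then UNIV else A e" and ?A2 = "\<lambda>e. if e = l then A e else UNIV"
    have box: "Pi\<^sub>E I C \<in> sets ?B" if "\<And>i. i \<in> I \<Longrightarrow> C i \<in> sets borel" for C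
      using I that by (intro sets_PiM_I_finite) auto
    have prob_box: "prob (V -` Pi\<^sub>E I C \<inter> space M) = (\<Prod>i\<in>I. measure P (C i))"
      if "\<And>i. i \<in> I \<Longrightarrow> C i \<in> sets borel" "V \<in> measurable M ?B" "distr M ?B V = PiM I (\<lambda>_. P)"
      for C V
    proof -
      have "prob (V -` Pi\<^sub>E I C \<inter> space M) = measure (PiM I (\<lambda>_. P)) (Pi\<^sub>E I C)"
        using that(2) box[OF that(1)] by (simp flip: that(3) add: measure_distr)
      also have "\<dots> = (\<Prod>i\<in>I. measure P (C i))"
      proof -
        have "emeasure (PiM I (\<lambda>_. P)) (Pi\<^sub>E I C) = (\<Prod>i\<in>I. emeasure P (C i))"
          using that(1) P(2) I by (intro emeasure_PiM) auto
        also have "\<dots> = ennreal (\<Prod>i\<in>I. measure P (C i))"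
          by (simp add: P.emeasure_eq_measure prod_ennreal)
        finally show ?thesis
          by (simp add: measure_eq_emeasure_eq_ennreal prod_nonneg)
      qed
      finally show ?thesis .
    qed
    have A12: "?A1 i \<in> sets borel" "?A2 i \<in> sets borel" if "i \<in> I" for i
      using A that by auto
    have "?R -` Pi\<^sub>E I A \<inter> space M = (\<lambda>\<omega>. (?X \<omega>, ?Y \<omega>)) -` (Pi\<^sub>E I ?A1 \<times> Pi\<^sub>E I ?A2) \<inter> space M"
      using I(2) unfolding replace_block_def set_eq_iff by (fastforce simp: restrict_PiE_iff Pi_iff split: if_splits)
    then have "prob (?R -` Pi\<^sub>E I A \<inter> space M) =
        prob (?X -` Pi\<^sub>E I ?A1 \<inter> space M) * prob (?Y -` Pi\<^sub>E I ?A2 \<inter> space M)"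
      using indep_varD[OF ind box[of ?A1] box[of ?A2]] A12 by simp
    also have "\<dots> = (\<Prod>i\<in>I. measure P (?A1 i)) * (\<Prod>i\<in>I. measure P (?A2 i))"
      using A12 by (simp only: prob_box[OF A12(1) X_meas law] prob_box[OF A12(2) Y_meas lawY])
    also have "\<dots> = (\<Prod>i\<in>I. measure P (A i))"
      using P.prob_space sets_eq_imp_space_eq[OF P(2)]
      by (auto simp flip: prod.distrib intro!: prod.cong)
    finally show "emeasure (distr M ?B ?R) (Pi\<^sub>E I A) = (\<Prod>i\<in>I. emeasure P (A i))"
      using R_meas box[of A] A
      by (simp add: emeasure_distr emeasure_eq_measure P.emeasure_eq_measure prod_ennreal)
  qed (rule I)
qed

section \<open>Markov bound for the number of blocks that change the optimum\<close>

text \<open>The threshold 2 is the first integer above the packing number of a single assignment.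
  The bound is the quotient of the mean \<open>2 * n\<close> of the count \<open>Z\<close> by the
  number \<open>\<epsilon> * n^2\<close> of changed blocks that can be discarded.\<close>

lemma (in prob_space) prob_min_packing_ge_2:
  fixes X :: "nat \<times> nat \<Rightarrow> 'a \<Rightarrow> real" and Y :: "nat \<times> nat \<Rightarrow> nat \<times> nat \<Rightarrow> 'a \<Rightarrow> real"
    and P :: "real measure" and n :: nat
  defines "I \<equiv> assignment_index n"
  defines "R \<equiv> \<lambda>l \<omega>. replace_block {l} (\<lambda>e. X e \<omega>) (\<lambda>e. Y l e \<omega>)"
  assumes n: "n \<ge> 1" and \<epsilon>: "\<epsilon> > 0"
    and P: "prob_space P" "sets P = sets borel" "\<And>c. emeasure P {c} = 0"
    and X_meas: "\<And>e. e \<in> I \<Longrightarrow> X e \<in> borel_measurable M"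
    and law: "distr M (PiM I (\<lambda>_. borel)) (\<lambda>\<omega>. \<lambda>e\<in>I. X e \<omega>) = PiM I (\<lambda>_. P)"
    and copy: "\<And>l. l \<in> I \<Longrightarrow> independent_copy M I X (Y l)"
  shows "measure M {\<omega> \<in> space M.
      real (Min {packing_number ((\<lambda>l. optimal_assignment n (R l \<omega>)) ` A) d \<epsilon>
        |A. A \<subseteq> I \<and> real (card A) > (1 - \<epsilon>) * real (card I)}) \<ge> 2} \<le> 2 / (\<epsilon> * real n)"
    (is "measure M {\<omega> \<in> space M. real (?m \<omega>) \<ge> 2} \<le> _")
proof -
  let ?Q = "PiM I (\<lambda>_. P)" and ?B = "PiM I (\<lambda>_. borel :: real measure)"
  have fin: "finite I" by (simp add: I_def)
  have card_I: "card I = n\<^sup>2" by (simp add: I_def assignment_index_def power2_eq_square)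
  define U where "U l = {x \<in> space ?Q. l \<in> used_edges n x}" for l
  have U_sets: "U l \<in> sets ?B" for l
  proof -
    have "U l \<in> sets ?Q" unfolding U_def I_def by (rule sets_used_edges[OF P(2)])
    moreover have "sets ?Q = sets ?B" using P(2) by (intro sets_PiM_cong) auto
    ultimately show ?thesis by simp
  qed
  \<comment> \<open>Membership in \<open>used_edges\<close> depends only on the restricted cost
    vector, so its probability depends only on the law of that vector. This is applied to the
    original costs and to each \<open>R l\<close>, which share the law \<open>?Q\<close>.\<close>
  have pullback: "{\<omega> \<in> space M. l \<in> used_edges n (V \<omega>)} \<in> sets M \<and>
      prob {\<omega> \<in> space M. l \<in> used_edges n (V \<omega>)} = measure ?Q (U l)"
    if meas: "(\<lambda>\<omega>. \<lambda>e\<in>I. V \<omega> e) \<in> measurable M ?B"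
      and V_law: "distr M ?B (\<lambda>\<omega>. \<lambda>e\<in>I. V \<omega> e) = ?Q" for V l
  proof -
    have sp: "space ?Q = space ?B"
      using sets_eq_imp_space_eq[OF P(2)] by (simp add: space_PiM)
    have eq: "{\<omega> \<in> space M. l \<in> used_edges n (V \<omega>)} = (\<lambda>\<omega>. \<lambda>e\<in>I. V \<omega> e) -` U l \<inter> space M"
      using measurable_space[OF meas] by (auto simp: U_def sp used_edges_restrict[of n, folded I_def])
    show ?thesis
      using measurable_sets[OF meas U_sets[of l]] measure_distr[OF meas U_sets[of l]]
      by (simp add: eq V_law)
  qed
  have X_vec: "(\<lambda>\<omega>. \<lambda>e\<in>I. X e \<omega>) \<in> measurable M ?B"
    using X_meas by (rule measurable_restrict)
  let ?EX = "\<lambda>l. {\<omega> \<in> space M. l \<in> used_edges n (\<lambda>e. X e \<omega>)}"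
  let ?ER = "\<lambda>l. {\<omega> \<in> space M. l \<in> used_edges n (R l \<omega>)}"
  have EX: "?EX l \<in> sets M" "prob (?EX l) = measure ?Q (U l)" for l
    using pullback[OF X_vec law] by auto
  have ER: "?ER l \<in> sets M" "prob (?ER l) = measure ?Q (U l)" if "l \<in> I" for l
    using pullback[of "R l" l] distr_replace_one[OF fin that P(1,2) law copy[OF that]]
    by (auto simp: R_def)
  \<comment> \<open>\<open>Z\<close> bounds the number of blocks that change the optimum; an edge
    used both before and after is counted twice.\<close>
  define Z where "Z \<omega> = (\<Sum>l\<in>I. indicator (?EX l) \<omega> + indicator (?ER l) \<omega> :: real)" for \<omega>
  have int: "integrable M (\<lambda>\<omega>. indicator (?EX l) \<omega> + indicator (?ER l) \<omega> :: real)" if "l \<in> I" for l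
    using EX(1) ER(1)[OF that] by (intro Bochner_Integration.integrable_add integrable_real_indicator)
      (auto simp: emeasure_eq_measure)
  have Z_int: "integrable M Z"
    unfolding Z_def using int by (rule Bochner_Integration.integrable_sum)
  have "expectation Z = (\<Sum>l\<in>I. expectation (\<lambda>\<omega>. indicator (?EX l) \<omega> + indicator (?ER l) \<omega>))"
    unfolding Z_def using int by (rule Bochner_Integration.integral_sum)
  also have "\<dots> = (\<Sum>l\<in>I. 2 * measure ?Q (U l))"
  proof (rule sum.cong)
    fix l assume l: "l \<in> I"
    have "expectation (\<lambda>\<omega>. indicator (?EX l) \<omega> + indicator (?ER l) \<omega>) = prob (?EX l) + prob (?ER l)"
      using EX(1) ER(1)[OF l]
      by (subst Bochner_Integration.integral_add) (auto simp: emeasure_eq_measure Int_absorb2)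
    then show "expectation (\<lambda>\<omega>. indicator (?EX l) \<omega> + indicator (?ER l) \<omega>) = 2 * measure ?Q (U l)"
      using EX(2) ER(2)[OF l] by simp
  qed simp
  also have "\<dots> = 2 * real n"
    using sum_measure_used_edges[OF P, of n] by (simp add: U_def I_def flip: sum_distrib_left)
  finally have EZ: "expectation Z = 2 * real n" .
  have pos: "\<epsilon> * (real n)\<^sup>2 > 0" using n \<epsilon> by simp
  have large: "Z \<omega> \<ge> \<epsilon> * (real n)\<^sup>2"
    if \<omega>: "\<omega> \<in> space M" and unique: "minimizers n (\<lambda>e. X e \<omega>) = {\<pi>}" and bad: "real (?m \<omega>) \<ge> 2"
    for \<omega> \<pi>
  proof (rule ccontr)
    assume less: "\<not> Z \<omega> \<ge> \<epsilon> * (real n)\<^sup>2"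
    let ?a = "optimal_assignment n (\<lambda>e. X e \<omega>)"
    let ?C = "{l\<in>I. optimal_assignment n (R l \<omega>) \<noteq> ?a}"
    have "real (card ?C) = (\<Sum>l\<in>I. if optimal_assignment n (R l \<omega>) \<noteq> ?a then 1 else 0)"
      using fin by (simp flip: sum.inter_filter)
    also have "\<dots> \<le> Z \<omega>"
      unfolding Z_def
    proof (rule sum_mono)
      fix l assume "l \<in> I"
      show "(if optimal_assignment n (R l \<omega>) \<noteq> ?a then 1 else 0)
          \<le> (indicator (?EX l) \<omega> + indicator (?ER l) \<omega> :: real)"
        using optimal_assignment_replace_unused[OF unique, of l "\<lambda>e. Y l e \<omega>"] \<omega>
        by (auto simp: R_def indicator_def)
    qed
    finally have C: "real (card ?C) < \<epsilon> * (real n)\<^sup>2" using less by simp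
    have "{l\<in>I. optimal_assignment n (R l \<omega>) = ?a} = I - ?C" by auto
    then have "card {l\<in>I. optimal_assignment n (R l \<omega>) = ?a} + card ?C = card I"
      using fin by (simp add: card_Diff_subset card_mono)
    then have "real (card {l\<in>I. optimal_assignment n (R l \<omega>) = ?a}) + real (card ?C) = real (card I)"
      by (simp only: flip: of_nat_add)
    moreover have "real (card I) = (real n)\<^sup>2"
      by (simp add: card_I)
    ultimately have "real (card {l\<in>I. optimal_assignment n (R l \<omega>) = ?a}) > (1 - \<epsilon>) * real (card I)"
      using C by (simp only: left_diff_distrib mult_1)
    from min_packing_number_le_1[OF fin this, of d \<epsilon>] bad show False by simp
  qed
  have unique_AE: "AE \<omega> in M. \<exists>\<pi>. minimizers n (\<lambda>e. X e \<omega>) = {\<pi>}"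
  proof -
    have "AE x in distr M ?B (\<lambda>\<omega>. \<lambda>e\<in>I. X e \<omega>). \<exists>\<pi>. minimizers n x = {\<pi>}"
      unfolding law unfolding I_def by (rule AE_PiM_unique_minimizer[OF P])
    from AE_distrD[OF X_vec this] show ?thesis
      by (simp add: I_def minimizers_restrict)
  qed
  have "measure M {\<omega> \<in> space M. real (?m \<omega>) \<ge> 2} \<le> measure M {\<omega> \<in> space M. Z \<omega> \<ge> \<epsilon> * (real n)\<^sup>2}"
  proof (rule finite_measure_mono_AE)
    show "AE \<omega> in M. \<omega> \<in> {\<omega> \<in> space M. real (?m \<omega>) \<ge> 2} \<longrightarrow>
        \<omega> \<in> {\<omega> \<in> space M. Z \<omega> \<ge> \<epsilon> * (real n)\<^sup>2}"
      using unique_AE by eventually_elim (use large in blast)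
    show "{\<omega> \<in> space M. Z \<omega> \<ge> \<epsilon> * (real n)\<^sup>2} \<in> sets M"
      using borel_measurable_integrable[OF Z_int] by measurable
  qed
  also have "\<dots> \<le> expectation Z / (\<epsilon> * (real n)\<^sup>2)"
  proof (rule integral_Markov_inequality_measure[OF Z_int sets.empty_sets _ pos])
    show "AE \<omega> in M. 0 \<le> Z \<omega>" unfolding Z_def by (intro AE_I2 sum_nonneg) simp
  qed
  also have "\<dots> = 2 / (\<epsilon> * real n)"
    using n by (simp add: EZ power2_eq_square)
  finally show ?thesis .
qed

theorem theorem3p5p4:
  fixes P :: "real measure" and f :: "real \<Rightarrow> real"
    and M :: "nat \<Rightarrow> 'w measure"
    and X :: "nat \<Rightarrow> nat \<times> nat \<Rightarrow> 'w \<Rightarrow> real"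
    and Y :: "nat \<Rightarrow> nat \<times> nat \<Rightarrow> nat \<times> nat \<Rightarrow> 'w \<Rightarrow> real"
  assumes f_meas: "f \<in> borel_measurable borel"
    and f_nonneg: "\<And>x. 0 \<le> f x"
    and f_supp: "\<And>x. x < 0 \<Longrightarrow> f x = 0"
    and P_density: "P = density lborel (\<lambda>x. ennreal (f x))"
    and finite_mean: "integrable P (\<lambda>x. x)"
    and rejection: "rejection_assumption f"
    and prob: "\<And>n. n \<ge> 1 \<Longrightarrow> prob_space (M n)"
    and indep: "\<And>n. n \<ge> 1 \<Longrightarrow>
      prob_space.indep_vars (M n) (\<lambda>_. borel) (X n) (assignment_index n)"
    and ident: "\<And>n e. n \<ge> 1 \<Longrightarrow> e \<in> assignment_index n \<Longrightarrow> distr (M n) borel (X n e) = P"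
    and copies: "\<And>n l. n \<ge> 1 \<Longrightarrow> l \<in> assignment_index n \<Longrightarrow>
      independent_copy (M n) (assignment_index n) (X n) (Y n l)"
  shows "stable_under_small_perturbations M optimal_assignment perm_dist
           assignment_index assignment_index (\<lambda>n l. {l}) X Y"
  unfolding stable_under_small_perturbations_def
proof (intro conjI allI impI)
  show "finite (assignment_index n)" "(\<Union>l\<in>assignment_index n. {l}) = assignment_index n" for n
    by simp_all
next
  fix \<epsilon> \<delta> :: real
  assume \<epsilon>: "\<epsilon> > 0" and \<delta>: "\<delta> > 0"
  have sets_P: "sets P = sets borel" by (simp add: P_density)
  have atomless: "emeasure P {c} = 0" for c
  proof -
    have "{c} \<in> null_sets lborel" by (simp add: null_sets_def)
    moreover have "absolutely_continuous lborel P"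
      unfolding P_density by (rule absolutely_continuousI_density) (use f_meas in measurable)
    ultimately show ?thesis by (auto simp: absolutely_continuous_def)
  qed
  let ?p = "\<lambda>n. measure (M n) {\<omega> \<in> space (M n).
      real (Min {packing_number
        ((\<lambda>l. optimal_assignment n (replace_block {l} (\<lambda>e. X n e \<omega>) (\<lambda>e. Y n l e \<omega>))) ` A)
        (perm_dist n) \<epsilon> |A. A \<subseteq> assignment_index n \<and>
          real (card A) > (1 - \<epsilon>) * real (card (assignment_index n))}) \<ge> 2}"
  have bound: "?p n \<le> 2 / (\<epsilon> * real n)" if n: "n \<ge> 1" for n
  proof -
    interpret prob_space "M n" by (rule prob[OF n])
    have X_meas: "X n e \<in> borel_measurable (M n)" if "e \<in> assignment_index n" for e
      using indep[OF n] that by (auto simp: indep_vars_def2)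
    have e: "(1, 1) \<in> assignment_index n" using n by (simp add: assignment_index_def)
    have P: "prob_space P"
      using prob_space_distr[OF X_meas[OF e]] ident[OF n e] by simp
    have "distr (M n) (PiM (assignment_index n) (\<lambda>_. borel)) (\<lambda>\<omega>. \<lambda>e\<in>assignment_index n. X n e \<omega>)
        = PiM (assignment_index n) (\<lambda>e. distr (M n) borel (X n e))"
      using indep[OF n] indep_vars_iff_distr_eq_PiM'[of "assignment_index n" "X n" "\<lambda>_. borel"] e X_meas
      by blast
    also have "\<dots> = PiM (assignment_index n) (\<lambda>_. P)"
      by (rule PiM_cong) (simp_all add: ident[OF n])
    finally show ?thesis
      using copies[OF n]
      by (intro prob_min_packing_ge_2[OF n \<epsilon> P sets_P atomless X_meas]) auto
  qed
  have "(\<lambda>n. 2 / (\<epsilon> * real n)) \<longlonglongrightarrow> 0"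
    using tendsto_mult[OF tendsto_const[of "2 / \<epsilon>"] lim_1_over_n] by simp
  then have "eventually (\<lambda>n. 2 / (\<epsilon> * real n) < \<delta>) sequentially"
    using \<delta> by (rule order_tendstoD)
  then have "eventually (\<lambda>n. ereal (?p n) \<le> ereal \<delta>) sequentially"
    using eventually_ge_at_top[of 1]
  proof eventually_elim
    case (elim n)
    then show ?case using bound[of n] by simp
  qed
  then have "limsup (\<lambda>n. ereal (?p n)) \<le> ereal \<delta>"
    by (rule Limsup_bounded)
  then show "\<exists>K::real. limsup (\<lambda>n. ereal (measure (M n) {\<omega> \<in> space (M n).
      real (Min {packing_number
        ((\<lambda>l. optimal_assignment n (replace_block {l} (\<lambda>e. X n e \<omega>) (\<lambda>e. Y n l e \<omega>))) ` A)
        (perm_dist n) \<epsilon> |A. A \<subseteq> assignment_index n \<and>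
          real (card A) > (1 - \<epsilon>) * real (card (assignment_index n))}) \<ge> K})) \<le> ereal \<delta>"
    by (rule exI[of _ 2])
qed

end
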